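(* Let $n=|Ag|\geq 1$ and $\mathsf{X}\subseteq\{\mathbf{D2},\mathbf{D3},\mathbf{D4},\mathbf{D5}\}$. If a sequent $\Lambda$ is derivable in $\mathsf{G3DS}_{n}\mathsf{X}$, then $\Lambda$ is valid relative to $\mathsf{DS}_{n}\mathsf{X}$.
   Context: Language $\mathcal{L}_n$: $Ag=\{1,\dots,n\}$, $Atm$ countable set of atoms; formulas (negation normal form) $\phi::=p\mid\neg p\mid\phi\lor\phi\mid\phi\land\phi\mid\Box\phi\mid\Diamond\phi\mid[i]\phi\mid\langle i\rangle\phi\mid\otimes_i\phi\mid\ominus_i\phi$. A $\mathsf{DS}_n$-frame is $\langle W,R_\Box,\{R_{[i]}\}_{i\in Ag},\{R_{\otimes_i}\}_{i\in Ag}\rangle$, $W\neq\emptyset$, with: (C1) $R_\Box$ an equivalence relation; (C2) each $R_{[i]}\subseteq R_\Box$ an equivalence relation; (C3) for all $w$ and $u_1,\dots,u_n\in R_\Box(w)$, $\bigcap_i R_{[i]}(u_i)\neq\emptyset$; (D1) $R_\Box wv$ and $R_{\otimes_i}wu$ imply $R_{\otimes_i}vu$. Optional: (D2) each $w$ has an $R_{\otimes_i}$-successor; (D3) $R_{\otimes_i}\subseteq R_\Box$; (D4) $R_{\otimes_i}wv$, $R_{[i]}vu$ imply $R_{\otimes_i}wu$; (D5) each $w$ has $v$ with $R_{\otimes_i}wv$ and $R_{[i]}(v)\subseteq R_{\otimes_i}(w)$. $\mathsf{DS}_n\mathsf{X}$-frames additionally satisfy the properties in $\mathsf{X}$ (for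 all $i$); models add $V:Atm\to\mathcal{P}(W)$; $\Box,[i],\otimes_i$ are interpreted universally and $\Diamond,\langle i\rangle,\ominus_i$ existentially over $R_\Box,R_{[i]},R_{\otimes_i}$; literals, $\land,\lor$ classically. Sequents $\mathcal{R}\vdash\Gamma$: $\mathcal{R}$ a multiset of relational atoms $R_\Box xy,R_{[i]}xy,R_{\otimes_i}xy$, $\Gamma$ a multiset of labelled formulas $x:\phi$. For model $M$ and $I$ from labels to worlds, $M,I\models\mathcal{R}\vdash\Gamma$ iff, whenever all atoms of $\mathcal{R}$ hold under $I$, some $z:\phi\in\Gamma$ has $M,I(z)\Vdash\phi$; valid relative to $\mathsf{DS}_n\mathsf{X}$ means this holds for all $\mathsf{DS}_n\mathsf{X}$-models and all $I$. Paths: $x\sim^{\mathcal{R}}_i y$ iff $x=y$ or $x,y$ are connected by a chain of $R_{[i]}$-atoms of $\mathcal{R}$ taken in either direction; $x\sim^{\mathcal{R}}_\Diamond y$ likewise with $R_\Box$- or any $R_{[j]}$-atoms. Calculus $\mathsf{G3DS}_n$ (premise(s) $\Rightarrow$ conclusion; fresh = not in conclusion): (id) $\mathcal{R}\vdash x:p,x:\neg p,\Gamma$; ($\lor$) $x:\phi,x:\psi\Rightarrow x:\phi\lor\psi$; ($\land$) two premises $x:\phi$, $x:\psi\Rightarrow x:\phi\land\psi$; ($\Box$) $\mathcal{R},R_\Box xy\vdash y:\phi,\Gamma\Rightarrow\mathcal{R}\vdash x:\Box\phi,\Gamma$, $y$ fresh; ($\Diamond$) $\mathcal{R}\vdash x:\Diamond\phi,y:\phi,\Gamma\Rightarrow\mathcal{R}\vdash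 x:\Diamond\phi,\Gamma$ if $x\sim^{\mathcal{R}}_\Diamond y$; ($[i]$) analogous to ($\Box$) with $R_{[i]}$; ($\langle i\rangle$) analogous to ($\Diamond$) with condition $x\sim^{\mathcal{R}}_i y$; ($\otimes_i$) analogous to ($\Box$) with $R_{\otimes_i}$; ($\ominus_i$) $\mathcal{R},R_{\otimes_i}xy\vdash x:\ominus_i\phi,y:\phi,\Gamma\Rightarrow\mathcal{R},R_{\otimes_i}xy\vdash x:\ominus_i\phi,\Gamma$; (IOA) $\mathcal{R},R_{[1]}x_1y,\dots,R_{[n]}x_ny\vdash\Gamma\Rightarrow\mathcal{R}\vdash\Gamma$, $y$ fresh, $x_j\sim^{\mathcal{R}}_\Diamond x_{j+1}$ for all $j$; (D1$_i$) $\mathcal{R},R_{\otimes_i}xz,R_{\otimes_i}yz\vdash\Gamma\Rightarrow\mathcal{R},R_{\otimes_i}xz\vdash\Gamma$ if $x\sim^{\mathcal{R}}_\Diamond y$. Extra rules: (D2$_i$) $\mathcal{R},R_{\otimes_i}xy\vdash\Gamma\Rightarrow\mathcal{R}\vdash\Gamma$, $y$ fresh; (D3$_i$) $\mathcal{R},R_{\otimes_i}xy,R_\Box xy\vdash\Gamma\Rightarrow\mathcal{R},R_{\otimes_i}xy\vdash\Gamma$; (D4$_i$) $\mathcal{R},R_{\otimes_i}xy,R_{\otimes_i}xz\vdash\Gamma\Rightarrow\mathcal{R},R_{\otimes_i}xy\vdash\Gamma$ if $y\sim^{\mathcal{R}}_i z$; (D5$_i$) the system of (D5$^1_i$) $\mathcal{R},R_{\otimes_i}xy\vdash\Gamma\Rightarrow\mathcal{R}\vdash\Gamma$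 ($y$ fresh) and (D5$^2_i$) $\mathcal{R}',R_{\otimes_i}xz\vdash\Gamma'\Rightarrow\mathcal{R}'\vdash\Gamma'$ where $y\sim^{\mathcal{R}'}_i z$ and $R_{\otimes_i}xy$ was introduced by an application of (D5$^1_i$) further down in the derivation. $\mathsf{G3DS}_n\mathsf{X}$ is $\mathsf{G3DS}_n$ plus (D$K_i$) for all $i$ whenever $\mathbf{D}K\in\mathsf{X}$. Derivations are finite trees with (id) leaves. *)

theory Defs
  imports "HOL-Library.Multiset" "HOL-Library.Countable"
begin

definition Ag :: "nat \<Rightarrow> nat set" where
  "Ag n = {1..n}"

datatype 'a fm =
    Atom 'a
  | NegAtom 'a
  | Or "'a fm" "'a fm"
  | And "'a fm" "'a fm"
  | Box "'a fm"
  | Dia "'a fm"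
  | AgBox nat "'a fm"
  | AgDia nat "'a fm"
  | Ought nat "'a fm"      \<comment> \<open>\<open>\<otimes>\<^sub>i\<close>\<close>
  | Permit nat "'a fm"     \<comment> \<open>\<open>\<ominus>\<^sub>i\<close>\<close>

primrec in_lang :: "nat \<Rightarrow> 'a fm \<Rightarrow> bool" where
  "in_lang n (Atom p) \<longleftrightarrow> True"
| "in_lang n (NegAtom p) \<longleftrightarrow> True"
| "in_lang n (Or \<phi> \<psi>) \<longleftrightarrow> in_lang n \<phi> \<and> in_lang n \<psi>"
| "in_lang n (And \<phi> \<psi>) \<longleftrightarrow> in_lang n \<phi> \<and> in_lang n \<psi>"
| "in_lang n (Box \<phi>) \<longleftrightarrow> in_lang n \<phi>"
| "in_lang n (Dia \<phi>) \<longleftrightarrow> in_lang n \<phi>"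
| "in_lang n (AgBox i \<phi>) \<longleftrightarrow> i \<in> Ag n \<and> in_lang n \<phi>"
| "in_lang n (AgDia i \<phi>) \<longleftrightarrow> i \<in> Ag n \<and> in_lang n \<phi>"
| "in_lang n (Ought i \<phi>) \<longleftrightarrow> i \<in> Ag n \<and> in_lang n \<phi>"
| "in_lang n (Permit i \<phi>) \<longleftrightarrow> i \<in> Ag n \<and> in_lang n \<phi>"

subsection \<open>Frames and models\<close>

text \<open>The agent-indexed relations are only meaningful at indices in \<open>Ag n\<close>.\<close>

record 'w frame =
  Worlds :: "'w set"
  RBox :: "('w \<times> 'w) set"
  RAg :: "nat \<Rightarrow> ('w \<times> 'w) set"
  ROught :: "nat \<Rightarrow> ('w \<times> 'w) set"

record ('w, 'a) model = "'w frame" +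
  Val :: "'a \<Rightarrow> 'w set"

datatype frame_prop = D2 | D3 | D4 | D5

definition DS_frame :: "nat \<Rightarrow> ('w, 'b) frame_scheme \<Rightarrow> bool" where
  "DS_frame n F \<longleftrightarrow>
     Worlds F \<noteq> {} \<and>
     (\<forall>i\<in>Ag n. ROught F i \<subseteq> Worlds F \<times> Worlds F) \<and>
     equiv (Worlds F) (RBox F) \<and>
     (\<forall>i\<in>Ag n. RAg F i \<subseteq> RBox F \<and> equiv (Worlds F) (RAg F i)) \<and>
     (\<forall>w\<in>Worlds F. \<forall>u. (\<forall>i\<in>Ag n. u i \<in> RBox F `` {w}) \<longrightarrow>
        (\<Inter>i\<in>Ag n. RAg F i `` {u i}) \<noteq> {}) \<and>
     (\<forall>i\<in>Ag n. \<forall>w v u. (w, v) \<in> RBox F \<and> (w, u) \<in> ROught F i \<longrightarrow> (v, u) \<in> ROught F i)"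

primrec satisfies_prop :: "nat \<Rightarrow> ('w, 'b) frame_scheme \<Rightarrow> frame_prop \<Rightarrow> bool" where
  "satisfies_prop n F D2 \<longleftrightarrow>
     (\<forall>i\<in>Ag n. \<forall>w\<in>Worlds F. \<exists>v. (w, v) \<in> ROught F i)"
| "satisfies_prop n F D3 \<longleftrightarrow>
     (\<forall>i\<in>Ag n. ROught F i \<subseteq> RBox F)"
| "satisfies_prop n F D4 \<longleftrightarrow>
     (\<forall>i\<in>Ag n. \<forall>w v u. (w, v) \<in> ROught F i \<and> (v, u) \<in> RAg F i \<longrightarrow> (w, u) \<in> ROught F i)"
| "satisfies_prop n F D5 \<longleftrightarrow>
     (\<forall>i\<in>Ag n. \<forall>w\<in>Worlds F. \<exists>v. (w, v) \<in> ROught F i \<and> RAg F i `` {v} \<subseteq> ROught F i `` {w})"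

definition DSX_frame :: "nat \<Rightarrow> frame_prop set \<Rightarrow> ('w, 'b) frame_scheme \<Rightarrow> bool" where
  "DSX_frame n X F \<longleftrightarrow> DS_frame n F \<and> (\<forall>P\<in>X. satisfies_prop n F P)"

definition DSX_model :: "nat \<Rightarrow> frame_prop set \<Rightarrow> ('w, 'a) model \<Rightarrow> bool" where
  "DSX_model n X M \<longleftrightarrow> DSX_frame n X M \<and> (\<forall>p. Val M p \<subseteq> Worlds M)"

primrec sat :: "('w, 'a) model \<Rightarrow> 'w \<Rightarrow> 'a fm \<Rightarrow> bool" where
  "sat M w (Atom p) \<longleftrightarrow> w \<in> Val M p"
| "sat M w (NegAtom p) \<longleftrightarrow> w \<notin> Val M p"
| "sat M w (Or \<phi> \<psi>) \<longleftrightarrow> sat M w \<phi> \<or> sat M w \<psi>"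
| "sat M w (And \<phi> \<psi>) \<longleftrightarrow> sat M w \<phi> \<and> sat M w \<psi>"
| "sat M w (Box \<phi>) \<longleftrightarrow> (\<forall>v. (w, v) \<in> RBox M \<longrightarrow> sat M v \<phi>)"
| "sat M w (Dia \<phi>) \<longleftrightarrow> (\<exists>v. (w, v) \<in> RBox M \<and> sat M v \<phi>)"
| "sat M w (AgBox i \<phi>) \<longleftrightarrow> (\<forall>v. (w, v) \<in> RAg M i \<longrightarrow> sat M v \<phi>)"
| "sat M w (AgDia i \<phi>) \<longleftrightarrow> (\<exists>v. (w, v) \<in> RAg M i \<and> sat M v \<phi>)"
| "sat M w (Ought i \<phi>) \<longleftrightarrow> (\<forall>v. (w, v) \<in> ROught M i \<longrightarrow> sat M v \<phi>)"
| "sat M w (Permit i \<phi>) \<longleftrightarrow> (\<exists>v. (w, v) \<in> ROught M i \<and> sat M v \<phi>)"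

subsection \<open>Labelled sequents\<close>

datatype 'l ratom =
    BoxAt 'l 'l
  | AgAt nat 'l 'l
  | OughtAt nat 'l 'l

datatype ('l, 'a) sequent =
  Sequent "'l ratom multiset" "('l \<times> 'a fm) multiset"  (infix "\<turnstile>" 50)

fun ratom_over :: "nat \<Rightarrow> 'l ratom \<Rightarrow> bool" where
  "ratom_over n (BoxAt x y) \<longleftrightarrow> True"
| "ratom_over n (AgAt i x y) \<longleftrightarrow> i \<in> Ag n"
| "ratom_over n (OughtAt i x y) \<longleftrightarrow> i \<in> Ag n"

fun sequent_over :: "nat \<Rightarrow> ('l, 'a) sequent \<Rightarrow> bool" where
  "sequent_over n (\<R> \<turnstile> \<Gamma>) \<longleftrightarrow>
     (\<forall>a\<in>#\<R>. ratom_over n a) \<and> (\<forall>(x, \<phi>)\<in>#\<Gamma>. in_lang n \<phi>)"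

fun labels :: "('l, 'a) sequent \<Rightarrow> 'l set" where
  "labels (\<R> \<turnstile> \<Gamma>) = (\<Union>a\<in>set_mset \<R>. set_ratom a) \<union> fst ` set_mset \<Gamma>"

fun ratom_holds :: "('w, 'a) model \<Rightarrow> ('l \<Rightarrow> 'w) \<Rightarrow> 'l ratom \<Rightarrow> bool" where
  "ratom_holds M I (BoxAt x y) \<longleftrightarrow> (I x, I y) \<in> RBox M"
| "ratom_holds M I (AgAt i x y) \<longleftrightarrow> (I x, I y) \<in> RAg M i"
| "ratom_holds M I (OughtAt i x y) \<longleftrightarrow> (I x, I y) \<in> ROught M i"

fun sequent_holds :: "('w, 'a) model \<Rightarrow> ('l \<Rightarrow> 'w) \<Rightarrow> ('l, 'a) sequent \<Rightarrow> bool" where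
  "sequent_holds M I (\<R> \<turnstile> \<Gamma>) \<longleftrightarrow>
     ((\<forall>a\<in>#\<R>. ratom_holds M I a) \<longrightarrow> (\<exists>(z, \<phi>)\<in>#\<Gamma>. sat M (I z) \<phi>))"

text \<open>
  HOL cannot quantify over types inside a formula, so the type of worlds is an explicit
  parameter; a theorem in which \<open>'w\<close> is a free type variable covers all models.
\<close>

definition valid :: "'w itself \<Rightarrow> nat \<Rightarrow> frame_prop set \<Rightarrow> ('l, 'a) sequent \<Rightarrow> bool" where
  "valid _ n X \<Lambda> \<longleftrightarrow>
     (\<forall>(M :: ('w, 'a) model) I. DSX_model n X M \<and> (\<forall>x. I x \<in> Worlds M) \<longrightarrow> sequent_holds M I \<Lambda>)"

subsection \<open>The calculus\<close>

definition ag_path :: "nat \<Rightarrow> 'l ratom multiset \<Rightarrow> 'l \<Rightarrow> 'l \<Rightarrow> bool" where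
  "ag_path i \<R> x y \<longleftrightarrow>
     (let S = {(u, v). AgAt i u v \<in># \<R>} in (x, y) \<in> (S \<union> S\<inverse>)\<^sup>*)"

definition dia_path :: "nat \<Rightarrow> 'l ratom multiset \<Rightarrow> 'l \<Rightarrow> 'l \<Rightarrow> bool" where
  "dia_path n \<R> x y \<longleftrightarrow>
     (let S = {(u, v). BoxAt u v \<in># \<R> \<or> (\<exists>j\<in>Ag n. AgAt j u v \<in># \<R>)} in (x, y) \<in> (S \<union> S\<inverse>)\<^sup>*)"

text \<open>
  In \<open>G3DS n X B \<Lambda>\<close> the set \<open>B\<close> consists of the relational atoms introduced by applications of
  \<open>D5_1\<close> on the branch between \<open>\<Lambda>\<close> and the root, which is what the side condition of \<open>D5_2\<close>
  refers to. At the root nothing has been introduced yet, so a complete derivation has \<open>B = {}\<close>.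

  In \<open>D2\<close> and \<open>D5_1\<close> the label \<open>x\<close> need not occur in the conclusion, so that \<open>y \<noteq> x\<close> has to be
  required separately. Without it, these rules could introduce a reflexive atom
  \<open>OughtAt i y y\<close>, which is unsound.
\<close>

inductive G3DS :: "nat \<Rightarrow> frame_prop set \<Rightarrow> 'l ratom set \<Rightarrow> ('l, 'a) sequent \<Rightarrow> bool"
  for n :: nat and X :: "frame_prop set" where
  ax: "G3DS n X B (\<R> \<turnstile> \<Gamma> + {#(x, Atom p), (x, NegAtom p)#})"
| disj: "G3DS n X B (\<R> \<turnstile> \<Gamma> + {#(x, \<phi>), (x, \<psi>)#}) \<Longrightarrow>
    G3DS n X B (\<R> \<turnstile> \<Gamma> + {#(x, Or \<phi> \<psi>)#})"
| conj: "G3DS n X B (\<R> \<turnstile> \<Gamma> + {#(x, \<phi>)#}) \<Longrightarrow> G3DS n X B (\<R> \<turnstile> \<Gamma> + {#(x, \<psi>)#}) \<Longrightarrow>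
    G3DS n X B (\<R> \<turnstile> \<Gamma> + {#(x, And \<phi> \<psi>)#})"
| box: "G3DS n X B (\<R> + {#BoxAt x y#} \<turnstile> \<Gamma> + {#(y, \<phi>)#}) \<Longrightarrow>
    y \<notin> labels (\<R> \<turnstile> \<Gamma> + {#(x, Box \<phi>)#}) \<Longrightarrow>
    G3DS n X B (\<R> \<turnstile> \<Gamma> + {#(x, Box \<phi>)#})"
| dia: "G3DS n X B (\<R> \<turnstile> \<Gamma> + {#(x, Dia \<phi>), (y, \<phi>)#}) \<Longrightarrow>
    dia_path n \<R> x y \<Longrightarrow>
    G3DS n X B (\<R> \<turnstile> \<Gamma> + {#(x, Dia \<phi>)#})"
| ag_box: "i \<in> Ag n \<Longrightarrow>
    G3DS n X B (\<R> + {#AgAt i x y#} \<turnstile> \<Gamma> + {#(y, \<phi>)#}) \<Longrightarrow>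
    y \<notin> labels (\<R> \<turnstile> \<Gamma> + {#(x, AgBox i \<phi>)#}) \<Longrightarrow>
    G3DS n X B (\<R> \<turnstile> \<Gamma> + {#(x, AgBox i \<phi>)#})"
| ag_dia: "i \<in> Ag n \<Longrightarrow>
    G3DS n X B (\<R> \<turnstile> \<Gamma> + {#(x, AgDia i \<phi>), (y, \<phi>)#}) \<Longrightarrow>
    ag_path i \<R> x y \<Longrightarrow>
    G3DS n X B (\<R> \<turnstile> \<Gamma> + {#(x, AgDia i \<phi>)#})"
| ought: "i \<in> Ag n \<Longrightarrow>
    G3DS n X B (\<R> + {#OughtAt i x y#} \<turnstile> \<Gamma> + {#(y, \<phi>)#}) \<Longrightarrow>
    y \<notin> labels (\<R> \<turnstile> \<Gamma> + {#(x, Ought i \<phi>)#}) \<Longrightarrow>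
    G3DS n X B (\<R> \<turnstile> \<Gamma> + {#(x, Ought i \<phi>)#})"
| permit: "i \<in> Ag n \<Longrightarrow>
    G3DS n X B (\<R> + {#OughtAt i x y#} \<turnstile> \<Gamma> + {#(x, Permit i \<phi>), (y, \<phi>)#}) \<Longrightarrow>
    G3DS n X B (\<R> + {#OughtAt i x y#} \<turnstile> \<Gamma> + {#(x, Permit i \<phi>)#})"
| IOA: "G3DS n X B (\<R> + {#AgAt j (xs j) y. j \<in># mset_set (Ag n)#} \<turnstile> \<Gamma>) \<Longrightarrow>
    y \<notin> labels (\<R> \<turnstile> \<Gamma>) \<Longrightarrow>
    (\<forall>j. 1 \<le> j \<and> j < n \<longrightarrow> dia_path n \<R> (xs j) (xs (j + 1))) \<Longrightarrow>
    G3DS n X B (\<R> \<turnstile> \<Gamma>)"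
| D1: "i \<in> Ag n \<Longrightarrow>
    G3DS n X B (\<R> + {#OughtAt i x z, OughtAt i y z#} \<turnstile> \<Gamma>) \<Longrightarrow>
    dia_path n \<R> x y \<Longrightarrow>
    G3DS n X B (\<R> + {#OughtAt i x z#} \<turnstile> \<Gamma>)"
| D2: "D2 \<in> X \<Longrightarrow> i \<in> Ag n \<Longrightarrow>
    G3DS n X B (\<R> + {#OughtAt i x y#} \<turnstile> \<Gamma>) \<Longrightarrow>
    y \<notin> labels (\<R> \<turnstile> \<Gamma>) \<Longrightarrow> y \<noteq> x \<Longrightarrow>
    G3DS n X B (\<R> \<turnstile> \<Gamma>)"
| D3: "D3 \<in> X \<Longrightarrow> i \<in> Ag n \<Longrightarrow>
    G3DS n X B (\<R> + {#OughtAt i x y, BoxAt x y#} \<turnstile> \<Gamma>) \<Longrightarrow>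
    G3DS n X B (\<R> + {#OughtAt i x y#} \<turnstile> \<Gamma>)"
| D4: "D4 \<in> X \<Longrightarrow> i \<in> Ag n \<Longrightarrow>
    G3DS n X B (\<R> + {#OughtAt i x y, OughtAt i x z#} \<turnstile> \<Gamma>) \<Longrightarrow>
    ag_path i \<R> y z \<Longrightarrow>
    G3DS n X B (\<R> + {#OughtAt i x y#} \<turnstile> \<Gamma>)"
| D5_1: "D5 \<in> X \<Longrightarrow> i \<in> Ag n \<Longrightarrow>
    G3DS n X (insert (OughtAt i x y) B) (\<R> + {#OughtAt i x y#} \<turnstile> \<Gamma>) \<Longrightarrow>
    y \<notin> labels (\<R> \<turnstile> \<Gamma>) \<Longrightarrow> y \<noteq> x \<Longrightarrow>
    G3DS n X B (\<R> \<turnstile> \<Gamma>)"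
| D5_2: "D5 \<in> X \<Longrightarrow> i \<in> Ag n \<Longrightarrow>
    G3DS n X B (\<R> + {#OughtAt i x z#} \<turnstile> \<Gamma>) \<Longrightarrow>
    OughtAt i x y \<in> B \<Longrightarrow> ag_path i \<R> y z \<Longrightarrow>
    G3DS n X B (\<R> \<turnstile> \<Gamma>)"

definition derivable :: "nat \<Rightarrow> frame_prop set \<Rightarrow> ('l, 'a) sequent \<Rightarrow> bool" where
  "derivable n X \<Lambda> \<longleftrightarrow> G3DS n X {} \<Lambda>"

end

theory Submission
  imports Defs
begin

text \<open>
  Read bottom-up, every rule turns an interpretation refuting its conclusion into one refuting a
  premise, the new interpretation differing at most at the fresh label; axioms cannot be refuted.
  The system of rules \<open>D5_1\<close>, \<open>D5_2\<close> is not sound rule by rule: a refutation also has to remember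
  that each atom \<open>OughtAt i x y\<close> introduced by \<open>D5_1\<close> was interpreted by a witness of the frame
  condition, namely one with \<open>R\<^sub>i(y) \<subseteq> R\<^sub>\<otimes>\<^sub>i(x)\<close>. Such an atom stays in the sequent above its
  introduction, so a later choice of a fresh label does not change the interpretation of \<open>x\<close>, \<open>y\<close>.
\<close>

fun refutes :: "('w, 'a) model \<Rightarrow> ('l \<Rightarrow> 'w) \<Rightarrow> 'l ratom set \<Rightarrow> ('l, 'a) sequent \<Rightarrow> bool" where
  "refutes M I B (\<R> \<turnstile> \<Gamma>) \<longleftrightarrow>
     (\<forall>x. I x \<in> Worlds M) \<and>
     (\<forall>a\<in>#\<R>. ratom_holds M I a) \<and>
     (\<forall>(z, \<phi>)\<in>#\<Gamma>. \<not> sat M (I z) \<phi>) \<and>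
     B \<subseteq> set_mset \<R> \<and>
     (\<forall>i x y. OughtAt i x y \<in> B \<longrightarrow> RAg M i `` {I y} \<subseteq> ROught M i `` {I x})"

section \<open>Changing a refutation at a fresh label\<close>

lemma ratom_holds_cong:
  assumes "\<And>x. x \<in> set_ratom a \<Longrightarrow> I x = J x"
  shows "ratom_holds M I a \<longleftrightarrow> ratom_holds M J a"
  using assms by (cases a) auto

lemma refutes_fresh_update:
  assumes ref: "refutes M I B (\<R> \<turnstile> \<Gamma>)"
    and fresh: "y \<notin> labels (\<R> \<turnstile> \<Gamma>)"
    and v: "v \<in> Worlds M"
  obtains J where "refutes M J B (\<R> \<turnstile> \<Gamma>)" and "J y = v" and "\<And>x. x \<noteq> y \<Longrightarrow> J x = I x"
proof -
  have fresh_ratom: "y \<notin> set_ratom a" if "a \<in># \<R>" for a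
    using fresh that by auto
  have fresh_fm: "z \<noteq> y" if "(z, \<phi>) \<in># \<Gamma>" for z \<phi>
    using fresh that by force
  have "ratom_holds M (I(y := v)) a" if "a \<in># \<R>" for a
  proof -
    have "ratom_holds M (I(y := v)) a \<longleftrightarrow> ratom_holds M I a"
      using fresh_ratom[OF that] by (intro ratom_holds_cong) auto
    then show ?thesis using ref that by simp
  qed
  moreover have "\<not> sat M ((I(y := v)) z) \<phi>" if "(z, \<phi>) \<in># \<Gamma>" for z \<phi>
    using ref fresh_fm[OF that] that by auto
  moreover have "RAg M i `` {(I(y := v)) b} \<subseteq> ROught M i `` {(I(y := v)) a}"
    if "OughtAt i a b \<in> B" for i a b
  proof -
    \<comment> \<open>This is where the clause \<open>B \<subseteq> set_mset \<R>\<close> of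
      \<open>refutes\<close> pays off: freshness for the sequent becomes freshness for the recorded
      atoms.\<close>
    have "OughtAt i a b \<in># \<R>" using ref that by auto
    from fresh_ratom[OF this] have "a \<noteq> y" "b \<noteq> y" by auto
    then show ?thesis using ref that by simp
  qed
  ultimately have "refutes M (I(y := v)) B (\<R> \<turnstile> \<Gamma>)" using ref v by auto
  then show thesis by (rule that) simp_all
qed

section \<open>Syntactic paths between labels\<close>

lemma equiv_rtrancl_mem:
  assumes "equiv W E" and "(x, y) \<in> (S \<union> S\<inverse>)\<^sup>*" and "I x \<in> W"
    and S: "\<And>u v. (u, v) \<in> S \<Longrightarrow> (I u, I v) \<in> E"
  shows "(I x, I y) \<in> E"
  using assms(2)
proof induction
  case base
  then show ?case using assms(1,3) by (auto simp: equiv_def refl_on_def)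
next
  case (step y z)
  have "(I y, I z) \<in> E"
    using step.hyps(2) S assms(1) by (auto simp: equiv_def sym_def)
  with step.IH show ?case using assms(1) by (meson equivE transD)
qed

text \<open>A label that no edge touches is isolated, so the only chain starting or ending at it is
  the empty one.\<close>

lemma fresh_rtrancl_eq:
  assumes "(x, y) \<in> (S \<union> S\<inverse>)\<^sup>*" and "\<And>u v. (u, v) \<in> S \<Longrightarrow> u \<noteq> a \<and> v \<noteq> a"
  shows "x = a \<longleftrightarrow> y = a"
  using assms(1) by induction (use assms(2) in auto)

lemma dia_path_fresh:
  assumes "dia_path n \<R> x y" and "a \<notin> labels (\<R> \<turnstile> \<Gamma>)"
  shows "x = a \<longleftrightarrow> y = a"
  using assms unfolding dia_path_def Let_def
  by (elim fresh_rtrancl_eq) fastforce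

section \<open>Frame conditions, and paths read in a model\<close>

context
  fixes n :: nat and X :: "frame_prop set" and M :: "('w, 'a) model"
  assumes model: "DSX_model n X M"
begin

lemma frame: "DS_frame n M" and frame_props: "P \<in> X \<Longrightarrow> satisfies_prop n M P"
  using model by (auto simp: DSX_model_def DSX_frame_def)

lemma equiv_RBox: "equiv (Worlds M) (RBox M)"
  using frame by (simp add: DS_frame_def)

lemma equiv_RAg: "i \<in> Ag n \<Longrightarrow> equiv (Worlds M) (RAg M i)"
  using frame by (simp add: DS_frame_def)

lemma RAg_subset_RBox: "i \<in> Ag n \<Longrightarrow> RAg M i \<subseteq> RBox M"
  using frame by (simp add: DS_frame_def)

lemma RBox_ROught: "i \<in> Ag n \<Longrightarrow> (w, v) \<in> RBox M \<Longrightarrow> (w, u) \<in> ROught M i \<Longrightarrow> (v, u) \<in> ROught M i"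
  using frame unfolding DS_frame_def by blast

lemma RBox_Worlds: "(w, v) \<in> RBox M \<Longrightarrow> v \<in> Worlds M"
  using equiv_RBox by (auto simp: equiv_def refl_on_def)

lemma RAg_Worlds: "i \<in> Ag n \<Longrightarrow> (w, v) \<in> RAg M i \<Longrightarrow> v \<in> Worlds M"
  using RAg_subset_RBox RBox_Worlds by blast

lemma ROught_Worlds: "i \<in> Ag n \<Longrightarrow> (w, v) \<in> ROught M i \<Longrightarrow> v \<in> Worlds M"
  using frame by (auto simp only: DS_frame_def)

lemma independence_of_agents:
  assumes "w \<in> Worlds M" and "\<And>i. i \<in> Ag n \<Longrightarrow> (w, u i) \<in> RBox M"
  obtains v where "\<And>i. i \<in> Ag n \<Longrightarrow> (u i, v) \<in> RAg M i"
proof -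
  have "(\<Inter>i\<in>Ag n. RAg M i `` {u i}) \<noteq> {}"
    using frame assms unfolding DS_frame_def by blast
  then show thesis using that by blast
qed

text \<open>Box edges hold by the refutation, agent edges because each \<open>RAg M i\<close> lies
  inside \<open>RBox M\<close>; as this is an equivalence, edges can be reversed and
  composed.\<close>

lemma dia_path_RBox:
  assumes "dia_path n \<R> x y" and "refutes M I B (\<R> \<turnstile> \<Gamma>)"
  shows "(I x, I y) \<in> RBox M"
  using assms(1) unfolding dia_path_def Let_def
  by (rule equiv_rtrancl_mem[OF equiv_RBox]) (use assms(2) RAg_subset_RBox in force)+

lemma ag_path_RAg:
  assumes "i \<in> Ag n" and "ag_path i \<R> x y" and "refutes M I B (\<R> \<turnstile> \<Gamma>)"
  shows "(I x, I y) \<in> RAg M i"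
  using assms(2) unfolding ag_path_def Let_def
  by (rule equiv_rtrancl_mem[OF equiv_RAg[OF assms(1)]]) (use assms(3) in force)+

text \<open>\<open>I\<close> is arbitrary in the induction because a fresh label gets a new value in
  the premise; \<open>B\<close> varies because \<open>D5_1\<close> enlarges it.\<close>

lemma G3DS_not_refutes:
  assumes "G3DS n X B \<Lambda>" and "n \<ge> 1"
  shows "\<not> refutes M I B \<Lambda>"
  using assms(1)
proof (induction arbitrary: I rule: G3DS.induct)
  case (ax B \<R> \<Gamma> x p)
  show ?case by auto
next
  case (disj B \<R> \<Gamma> x \<phi> \<psi>)
  show ?case using disj.IH[of I] by auto
next
  case (conj B \<R> \<Gamma> x \<phi> \<psi>)
  show ?case using conj.IH(1)[of I] conj.IH(2)[of I] by auto
next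
  case (box B \<R> x y \<Gamma> \<phi>)
  show ?case
  proof
    assume ref: "refutes M I B (\<R> \<turnstile> \<Gamma> + {#(x, Box \<phi>)#})"
    \<comment> \<open>The world falsifying the boxed formula becomes the value of the fresh label;
      \<open>ag_box\<close> and \<open>ought\<close> proceed alike.\<close>
    then obtain v where v: "(I x, v) \<in> RBox M" "\<not> sat M v \<phi>" by auto
    obtain J where J: "refutes M J B (\<R> \<turnstile> \<Gamma> + {#(x, Box \<phi>)#})" "J y = v"
      "\<And>x. x \<noteq> y \<Longrightarrow> J x = I x"
      using refutes_fresh_update[OF ref box.hyps(2)] v RBox_Worlds by blast
    have "x \<noteq> y" using box.hyps(2) by auto
    with J show False using box.IH[of J] v by auto
  qed
next
  case (dia B \<R> \<Gamma> x \<phi> y)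
  show ?case
  proof
    assume ref: "refutes M I B (\<R> \<turnstile> \<Gamma> + {#(x, Dia \<phi>)#})"
    have "(I x, I y) \<in> RBox M" using dia_path_RBox[OF dia.hyps(2) ref] .
    then show False using ref dia.IH[of I] by auto
  qed
next
  case (ag_box i B \<R> x y \<Gamma> \<phi>)
  show ?case
  proof
    assume ref: "refutes M I B (\<R> \<turnstile> \<Gamma> + {#(x, AgBox i \<phi>)#})"
    then obtain v where v: "(I x, v) \<in> RAg M i" "\<not> sat M v \<phi>" by auto
    obtain J where J: "refutes M J B (\<R> \<turnstile> \<Gamma> + {#(x, AgBox i \<phi>)#})" "J y = v"
      "\<And>x. x \<noteq> y \<Longrightarrow> J x = I x"
      using refutes_fresh_update[OF ref ag_box.hyps(3)] v RAg_Worlds ag_box.hyps(1) by blast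
    have "x \<noteq> y" using ag_box.hyps(3) by auto
    with J show False using ag_box.IH[of J] v by auto
  qed
next
  case (ag_dia i B \<R> \<Gamma> x \<phi> y)
  show ?case
  proof
    assume ref: "refutes M I B (\<R> \<turnstile> \<Gamma> + {#(x, AgDia i \<phi>)#})"
    have "(I x, I y) \<in> RAg M i" using ag_path_RAg[OF ag_dia.hyps(1,3) ref] .
    then show False using ref ag_dia.IH[of I] by auto
  qed
next
  case (ought i B \<R> x y \<Gamma> \<phi>)
  show ?case
  proof
    assume ref: "refutes M I B (\<R> \<turnstile> \<Gamma> + {#(x, Ought i \<phi>)#})"
    then obtain v where v: "(I x, v) \<in> ROught M i" "\<not> sat M v \<phi>" by auto
    obtain J where J: "refutes M J B (\<R> \<turnstile> \<Gamma> + {#(x, Ought i \<phi>)#})" "J y = v"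
      "\<And>x. x \<noteq> y \<Longrightarrow> J x = I x"
      using refutes_fresh_update[OF ref ought.hyps(3)] v ROught_Worlds ought.hyps(1) by blast
    have "x \<noteq> y" using ought.hyps(3) by auto
    with J show False using ought.IH[of J] v by auto
  qed
next
  case (permit i B \<R> x y \<Gamma> \<phi>)
  show ?case using permit.IH[of I] by auto
next
  case (IOA B \<R> xs y \<Gamma>)
  show ?case
  proof
    assume ref: "refutes M I B (\<R> \<turnstile> \<Gamma>)"
    \<comment> \<open>The side condition links only neighbours, so everything is compared with
      \<open>xs 1\<close> by induction. The second conjunct says that either all or none of the
      \<open>xs j\<close> equal \<open>y\<close>.\<close>
    have reach: "(I (xs 1), I (xs j)) \<in> RBox M \<and> (xs 1 = y \<longleftrightarrow> xs j = y)" if "1 \<le> j" "j \<le> n" for j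
      using that
    proof (induction j rule: dec_induct)
      case base
      then show ?case using equiv_RBox ref by (auto simp: equiv_def refl_on_def)
    next
      case (step j)
      then have "dia_path n \<R> (xs j) (xs (Suc j))" using IOA.hyps(3) by simp
      then have "(I (xs j), I (xs (Suc j))) \<in> RBox M" and "xs j = y \<longleftrightarrow> xs (Suc j) = y"
        using dia_path_RBox[OF _ ref] dia_path_fresh[OF _ IOA.hyps(2)] by blast+
      with step show ?case using equiv_RBox by (meson Suc_leD equivE transD)
    qed
    \<comment> \<open>The labels \<open>xs j\<close> need not occur in the sequent, so they may coincide with the fresh
      label \<open>y\<close>; but then all of them do, and the new atoms hold by reflexivity.\<close>
    show False
    proof (cases "xs 1 = y")
      case True
      have "(I (xs j), I y) \<in> RAg M j" if "j \<in> Ag n" for j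
        using reach[of j] True that equiv_RAg[OF that] ref
        by (auto simp: Ag_def equiv_def refl_on_def)
      then show False using ref IOA.IH[of I] by (auto simp: Ag_def)
    next
      case False
      obtain v where v: "\<And>j. j \<in> Ag n \<Longrightarrow> (I (xs j), v) \<in> RAg M j"
        using independence_of_agents[of "I (xs 1)" "\<lambda>j. I (xs j)"] reach ref
        by (auto simp: Ag_def)
      \<comment> \<open>One agent is needed to place \<open>v\<close> among the worlds: with no
        agents, the property of \<open>v\<close> would be vacuous.\<close>
      have "1 \<in> Ag n" using \<open>n \<ge> 1\<close> by (simp add: Ag_def)
      then have "v \<in> Worlds M" using v RAg_Worlds by blast
      then obtain J where J: "refutes M J B (\<R> \<turnstile> \<Gamma>)" "J y = v"
        "\<And>x. x \<noteq> y \<Longrightarrow> J x = I x"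
        using refutes_fresh_update[OF ref IOA.hyps(2)] by blast
      have "xs j \<noteq> y" if "j \<in> Ag n" for j
        using reach[of j] False that by (auto simp: Ag_def)
      with J show False using IOA.IH[of J] v by (auto simp: Ag_def)
    qed
  qed
next
  case (D1 i B \<R> x z y \<Gamma>)
  show ?case
  proof
    assume ref: "refutes M I B (\<R> + {#OughtAt i x z#} \<turnstile> \<Gamma>)"
    \<comment> \<open>Paths ignore \<open>OughtAt\<close> atoms, so the path in \<open>\<R>\<close>
      is also one in the full antecedent, which \<open>ref\<close> speaks about. The case
      \<open>D4\<close> uses the same remark for \<open>ag_path\<close>.\<close>
    have "dia_path n (\<R> + {#OughtAt i x z#}) x y" using D1.hyps(3) by (simp add: dia_path_def)
    then have "(I x, I y) \<in> RBox M" using ref by (rule dia_path_RBox)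
    then have "(I y, I z) \<in> ROught M i" using RBox_ROught[OF D1.hyps(1)] ref by simp
    then show False using ref D1.IH[of I] by auto
  qed
next
  case (D2 i B \<R> x y \<Gamma>)
  show ?case
  proof
    assume ref: "refutes M I B (\<R> \<turnstile> \<Gamma>)"
    then obtain v where v: "(I x, v) \<in> ROught M i"
      using frame_props[OF D2.hyps(1)] D2.hyps(2)
      unfolding refutes.simps satisfies_prop.simps by blast
    obtain J where J: "refutes M J B (\<R> \<turnstile> \<Gamma>)" "J y = v"
      "\<And>x. x \<noteq> y \<Longrightarrow> J x = I x"
      using refutes_fresh_update[OF ref D2.hyps(4)] v ROught_Worlds D2.hyps(2) by blast
    with J show False using D2.IH[of J] v D2.hyps(5) by auto
  qed
next
  case (D3 i B \<R> x y \<Gamma>)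
  show ?case using D3.IH[of I] frame_props[OF D3.hyps(1)] D3.hyps(2) by auto
next
  case (D4 i B \<R> x y z \<Gamma>)
  show ?case
  proof
    assume ref: "refutes M I B (\<R> + {#OughtAt i x y#} \<turnstile> \<Gamma>)"
    have "ag_path i (\<R> + {#OughtAt i x y#}) y z" using D4.hyps(4) by (simp add: ag_path_def)
    then have "(I y, I z) \<in> RAg M i" using ref by (rule ag_path_RAg[OF D4.hyps(2)])
    moreover have "(I x, I y) \<in> ROught M i" using ref by simp
    ultimately have "(I x, I z) \<in> ROught M i"
      using frame_props[OF D4.hyps(1)] D4.hyps(2) unfolding satisfies_prop.simps by blast
    then show False using ref D4.IH[of I] by auto
  qed
next
  case (D5_1 i x y B \<R> \<Gamma>)
  show ?case
  proof
    assume ref: "refutes M I B (\<R> \<turnstile> \<Gamma>)"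
    then have "I x \<in> Worlds M" by simp
    then obtain v where v: "(I x, v) \<in> ROught M i" "RAg M i `` {v} \<subseteq> ROught M i `` {I x}"
      using frame_props[OF D5_1.hyps(1)] D5_1.hyps(2) unfolding satisfies_prop.simps by meson
    obtain J where J: "refutes M J B (\<R> \<turnstile> \<Gamma>)" "J y = v"
      "\<And>x. x \<noteq> y \<Longrightarrow> J x = I x"
      using refutes_fresh_update[OF ref D5_1.hyps(4)] v ROught_Worlds D5_1.hyps(2) by blast
    \<comment> \<open>The recorded set and the antecedent grow by the same atom, and
      \<open>v\<close> was chosen to satisfy the new clause; \<open>y \<noteq> x\<close> ensures
      \<open>J x = I x\<close>.\<close>
    with J have "refutes M J (insert (OughtAt i x y) B) (\<R> + {#OughtAt i x y#} \<turnstile> \<Gamma>)"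
      using v D5_1.hyps(5) by (simp add: subset_insertI2)
    then show False using D5_1.IH by blast
  qed
next
  case (D5_2 i B \<R> x z \<Gamma> y)
  show ?case
  proof
    assume ref: "refutes M I B (\<R> \<turnstile> \<Gamma>)"
    have "(I y, I z) \<in> RAg M i" using ag_path_RAg[OF D5_2.hyps(2,5) ref] .
    \<comment> \<open>The property remembered since \<open>D5_1\<close> is used here; the frame
      condition itself would only give some witness, perhaps not \<open>I y\<close>.\<close>
    moreover have "RAg M i `` {I y} \<subseteq> ROught M i `` {I x}" using ref D5_2.hyps(4) by simp
    ultimately have "(I x, I z) \<in> ROught M i" by blast
    then show False using ref D5_2.IH[of I] by auto
  qed
qed

end

theorem theoremA1:
  fixes n :: nat
    and X :: "frame_prop set"
    and \<Lambda> :: "('l, 'a :: countable) sequent"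
  assumes "n \<ge> 1"
    and "X \<subseteq> {D2, D3, D4, D5}"
    and "sequent_over n \<Lambda>"
    and "derivable n X \<Lambda>"
  shows "valid TYPE('w) n X \<Lambda>"
  unfolding valid_def
proof (intro allI impI, elim conjE)
  fix M :: "('w, 'a) model" and I :: "'l \<Rightarrow> 'w"
  assume "DSX_model n X M" and I: "\<forall>x. I x \<in> Worlds M"
  \<comment> \<open>With \<open>B\<close> empty the last two clauses of \<open>refutes\<close> are
    trivial, so what is excluded is just an interpretation in \<open>M\<close> falsifying the
    sequent.\<close>
  then have "\<not> refutes M I {} \<Lambda>"
    using assms(1,4) G3DS_not_refutes unfolding derivable_def by blast
  with I show "sequent_holds M I \<Lambda>" by (cases \<Lambda>) auto
qed

end
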